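(* Let $\mathcal{X}\subseteq\mathbb{R}^d$ be a nonempty closed convex set, let $L>0$, and let $F:\mathcal{X}\to\mathbb{R}^d$ be monotone and $L$-Lipschitz, i.e. $\langle F(x)-F(y),x-y\rangle\ge 0$ and $\|F(x)-F(y)\|\le L\|x-y\|$ for all $x,y\in\mathcal{X}$. Assume that the variational inequality "find $x^*\in\mathcal{X}$ such that $\langle F(x^* ),x-x^*\rangle\ge 0$ for all $x\in\mathcal{X}$" has a solution, and let $x^*$ be any solution. Let $0<\gamma\le\frac{1}{4L}$, let $x^0\in\mathcal{X}$, and let $(x^k)_{k\ge 0}$, $(\widetilde{x}^k)_{k\ge 0}$ be the iterates of the projected past extragradient method with stepsize $\gamma$ started at $x^0$. For $k\ge 2$ define $$\Psi_k = \|x^{k} - x^{k-1}\|^2 + \|x^{k} - x^{k-1} - 2\gamma(F(x^{k}) - F(\widetilde{x}^{k-1}))\|^2,$$ $$\Phi_k = \|x^k - x^*\|^2 + \frac{1}{16}\|\widetilde{x}^{k-1} - \widetilde{x}^{k-2}\|^2 + \frac{3k + 32}{24}\Psi_k.$$ Then $\Phi_{k+1}\le\Phi_k$ for all $k\ge 2$. In particular, for all $N\ge 2$, $$\|x^{N} - x^{N-1}\|^2 \leq \frac{24H_{0,\gamma}^2}{3N+32},\qquad \mathrm{Gap}_F(x^N) \leq \frac{8\sqrt{3}\,H_{0,\gamma}\, H_0}{\gamma\sqrt{3N+32}},$$ where $H_0,H_{0,\gamma}\geq 0$ are given by $$H_{0,\gamma}^2 = 2(1 + 3\gamma^2L^2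 + 4\gamma^4 L^4)\|x^0 - x^*\|^2 + \left(\frac{41}{12} + \frac{19}{3}\gamma^2 L^2\right)\gamma^2\|F(x^0)\|^2,$$ $$H_{0}^2 = 3\|x^0 - x^*\|^2 + \frac{1}{30L^2}\|F(x^0)\|^2.$$
   Context: $\|\cdot\|$ and $\langle\cdot,\cdot\rangle$ are the Euclidean norm and inner product on $\mathbb{R}^d$, and $\mathrm{proj}[x]=\arg\min_{y\in\mathcal{X}}\|y-x\|^2$ is the Euclidean projection onto $\mathcal{X}$. Projected past extragradient method with stepsize $\gamma$: $\widetilde{x}^0=x^0\in\mathcal{X}$, $x^1=\mathrm{proj}[x^0-\gamma F(x^0)]$, and for all $k>0$, $$\widetilde{x}^k=\mathrm{proj}[x^k-\gamma F(\widetilde{x}^{k-1})],\qquad x^{k+1}=\mathrm{proj}[x^k-\gamma F(\widetilde{x}^k)].$$ Restricted gap function: for the fixed solution $x^*$ and starting point $x^0$, $$\mathrm{Gap}_F(x)=\max_{y\in\mathcal{X}:\ \|y-x^*\|\le R}\langle F(y),x-y\rangle,\qquad R=\sqrt{3}\,\|x^0-x^*\|+\frac{1}{\sqrt{30}\,L}\|F(x^0)\|.$$ *)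

theory Defs
  imports "HOL-Analysis.Analysis"
begin

definition monotone_operator_on ::
    "(real ^ 'd) set \<Rightarrow> (real ^ 'd \<Rightarrow> real ^ 'd) \<Rightarrow> bool" where
  "monotone_operator_on X F \<longleftrightarrow> (\<forall>x\<in>X. \<forall>y\<in>X. (F x - F y) \<bullet> (x - y) \<ge> 0)"

definition VI_solution ::
    "(real ^ 'd) set \<Rightarrow> (real ^ 'd \<Rightarrow> real ^ 'd) \<Rightarrow> real ^ 'd \<Rightarrow> bool" where
  "VI_solution X F xs \<longleftrightarrow> xs \<in> X \<and> (\<forall>x\<in>X. F xs \<bullet> (x - xs) \<ge> 0)"

text \<open>In the next definition \<open>x k\<close> and \<open>xt k\<close> are the main and the extrapolated iterates.
  \<open>closest_point X\<close> is the Euclidean projection onto the nonempty closed convex set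
  \<open>X\<close>. The operator \<open>F\<close> is only ever evaluated at points of \<open>X\<close>.\<close>

definition past_extragradient ::
    "(real ^ 'd) set \<Rightarrow> (real ^ 'd \<Rightarrow> real ^ 'd) \<Rightarrow> real
      \<Rightarrow> (nat \<Rightarrow> real ^ 'd) \<Rightarrow> (nat \<Rightarrow> real ^ 'd) \<Rightarrow> bool" where
  "past_extragradient X F \<gamma> x xt \<longleftrightarrow>
     x 0 \<in> X \<and> xt 0 = x 0 \<and>
     x 1 = closest_point X (x 0 - \<gamma> *\<^sub>R F (x 0)) \<and>
     (\<forall>k>0. xt k = closest_point X (x k - \<gamma> *\<^sub>R F (xt (k - 1))) \<and>
            x (k + 1) = closest_point X (x k - \<gamma> *\<^sub>R F (xt k)))"

definition gap_radius ::
    "(real ^ 'd \<Rightarrow> real ^ 'd) \<Rightarrow> real \<Rightarrow> real ^ 'd \<Rightarrow> real ^ 'd \<Rightarrow> real" where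
  "gap_radius F L x0 xs = sqrt 3 * norm (x0 - xs) + 1 / (sqrt 30 * L) * norm (F x0)"

text \<open>A maximum, not just a supremum: \<open>GREATEST\<close> is meaningful because \<open>F\<close> is
  continuous on \<open>X\<close> and the feasible points \<open>y\<close> form a nonempty compact set
  (it contains \<open>xs\<close>).\<close>

definition restricted_gap ::
    "(real ^ 'd) set \<Rightarrow> (real ^ 'd \<Rightarrow> real ^ 'd) \<Rightarrow> real \<Rightarrow> real ^ 'd \<Rightarrow> real ^ 'd
      \<Rightarrow> real ^ 'd \<Rightarrow> real" where
  "restricted_gap X F L x0 xs x =
     (GREATEST v. \<exists>y\<in>X. norm (y - xs) \<le> gap_radius F L x0 xs \<and> v = F y \<bullet> (x - y))"

definition Psi ::
    "(real ^ 'd \<Rightarrow> real ^ 'd) \<Rightarrow> real \<Rightarrow> (nat \<Rightarrow> real ^ 'd) \<Rightarrow> (nat \<Rightarrow> real ^ 'd) \<Rightarrow> nat \<Rightarrow> real" where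
  "Psi F \<gamma> x xt k =
     (norm (x k - x (k - 1)))\<^sup>2 +
     (norm (x k - x (k - 1) - (2 * \<gamma>) *\<^sub>R (F (x k) - F (xt (k - 1)))))\<^sup>2"

text \<open>The truncated subtraction \<open>k - 2\<close> is harmless, as \<open>Phi\<close> is only used for
  \<open>k \<ge> 2\<close>.\<close>

definition Phi ::
    "(real ^ 'd \<Rightarrow> real ^ 'd) \<Rightarrow> real \<Rightarrow> real ^ 'd
      \<Rightarrow> (nat \<Rightarrow> real ^ 'd) \<Rightarrow> (nat \<Rightarrow> real ^ 'd) \<Rightarrow> nat \<Rightarrow> real" where
  "Phi F \<gamma> xs x xt k =
     (norm (x k - xs))\<^sup>2 + 1 / 16 * (norm (xt (k - 1) - xt (k - 2)))\<^sup>2 +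
     (3 * real k + 32) / 24 * Psi F \<gamma> x xt k"

definition H0\<gamma> ::
    "(real ^ 'd \<Rightarrow> real ^ 'd) \<Rightarrow> real \<Rightarrow> real \<Rightarrow> real ^ 'd \<Rightarrow> real ^ 'd \<Rightarrow> real" where
  "H0\<gamma> F L \<gamma> x0 xs =
     sqrt (2 * (1 + 3 * \<gamma>\<^sup>2 * L\<^sup>2 + 4 * \<gamma> ^ 4 * L ^ 4) * (norm (x0 - xs))\<^sup>2 +
           (41 / 12 + 19 / 3 * \<gamma>\<^sup>2 * L\<^sup>2) * \<gamma>\<^sup>2 * (norm (F x0))\<^sup>2)"

definition H0 ::
    "(real ^ 'd \<Rightarrow> real ^ 'd) \<Rightarrow> real \<Rightarrow> real ^ 'd \<Rightarrow> real ^ 'd \<Rightarrow> real" where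
  "H0 F L x0 xs = sqrt (3 * (norm (x0 - xs))\<^sup>2 + 1 / (30 * L\<^sup>2) * (norm (F x0))\<^sup>2)"

end

theory Submission
  imports Defs
begin

text \<open>Write \<open>a = x\<^sub>k\<^sub>+\<^sub>1 - x\<^sub>k\<close>, \<open>b = x\<^sub>k - x\<^sub>k\<^sub>-\<^sub>1\<close>, \<open>d = xt\<^sub>k - x\<^sub>k\<close>. Averaging the variational
  inequalities of the three projections and adding monotonicity between \<open>x\<^sub>k\<close> and \<open>x\<^sub>k\<^sub>+\<^sub>1\<close>
  gives \<open>\<Psi>\<^sub>k\<^sub>+\<^sub>1 \<le> \<Psi>\<^sub>k - 3/4 \<parallel>a - d\<parallel>\<^sup>2\<close> for \<open>k \<ge> 1\<close>, while the standard distance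
  estimate makes \<open>\<parallel>x\<^sub>k - x\<^sup>*\<parallel>\<^sup>2 + 1/16 \<parallel>xt\<^sub>k\<^sub>-\<^sub>1 - xt\<^sub>k\<^sub>-\<^sub>2\<parallel>\<^sup>2\<close> drop by at least \<open>3/4 \<parallel>d\<parallel>\<^sup>2\<close>.
  Since \<open>\<Psi>\<^sub>k\<^sub>+\<^sub>1\<close> is bounded by a quadratic form in \<open>\<parallel>d\<parallel>\<close> and \<open>\<parallel>a - d\<parallel>\<close>, these two
  drops pay for the growth of the weight \<open>(3 k + 32)/24\<close>. For the gap, the mean of the two
  vectors in \<open>\<Psi>\<^sub>N\<close> is the residual of the variational inequality at \<open>x\<^sub>N\<close>.\<close>

section \<open>Quadratic inequalities in an inner product space\<close>

text \<open>Here \<open>g\<close> and \<open>g'\<close> stand for \<gamma>F at the current and the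
  previous extrapolated point, and \<open>g + e\<close>, \<open>g' + e'\<close> for \<gamma>F at the
  new and the old main iterate. The first hypothesis is monotonicity; the next four test the
  projections: new iterate against old, old against new, extrapolated against new, old against
  extrapolated.\<close>

lemma potential_descent:
  fixes a b d e e' g g' :: "'a::real_inner"
  assumes "(g + e - g' - e') \<bullet> a \<ge> 0"
    and "(a + g) \<bullet> a \<le> 0" and "(b + g') \<bullet> a \<ge> 0"
    and "(d + g') \<bullet> (a - d) \<ge> 0" and "(b + g') \<bullet> d \<ge> 0"
    and lip: "norm e \<le> norm (a - d) / 4"
  shows "(norm a)\<^sup>2 + (norm (a - 2 *\<^sub>R e))\<^sup>2
    \<le> (norm b)\<^sup>2 + (norm (b - 2 *\<^sub>R e'))\<^sup>2 - 3/4 * (norm (a - d))\<^sup>2"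
proof -
  have "(norm e)\<^sup>2 \<le> (norm (a - d) / 4)\<^sup>2"
    using lip by (intro power_mono) auto
  then have "16 * (e \<bullet> e) \<le> (a - d) \<bullet> (a - d)"
    by (simp add: power_divide power2_norm_eq_inner)
  moreover have "0 \<le> (a - b + 2 *\<^sub>R e') \<bullet> (a - b + 2 *\<^sub>R e')" and "0 \<le> (b - d) \<bullet> (b - d)"
    by simp_all
  \<comment> \<open>The right side minus the left is the sum of these: the monotonicity term and the
    slack of the second hypothesis, each times 4, the other three hypotheses times 2, the squared
    Lipschitz slack times 1/4, and the two squares. The weights are chosen so that \<open>g\<close>
    and \<open>g'\<close> cancel.\<close>
  ultimately show ?thesis
    using assms(1-5) unfolding power2_norm_eq_inner
    by (simp add: inner_simps inner_commute algebra_simps) argo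
qed

text \<open>With \<open>z\<close> the old iterate minus the solution, the slack is twice the sum of
  the three hypotheses (the first with reversed sign) plus the square completed in the
  proof.\<close>

lemma distance_descent:
  fixes a d g g' z :: "'a::real_inner"
  assumes "(a + g) \<bullet> (z + a) \<le> 0" and "(d + g') \<bullet> (a - d) \<ge> 0" and "g \<bullet> (z + d) \<ge> 0"
  shows "(norm (z + a))\<^sup>2 \<le> (norm z)\<^sup>2 - (norm d)\<^sup>2 + (norm (g - g'))\<^sup>2"
proof -
  have "0 \<le> (a - d + (g - g')) \<bullet> (a - d + (g - g'))"
    by simp
  then show ?thesis
    using assms unfolding power2_norm_eq_inner
    by (simp add: inner_simps inner_commute algebra_simps)
qed

lemma norm_add_power2_le:
  fixes u v :: "'a::real_inner"
  shows "(norm (u + v))\<^sup>2 \<le> 2 * (norm u)\<^sup>2 + 2 * (norm v)\<^sup>2"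
proof -
  have "0 \<le> (u - v) \<bullet> (u - v)"
    by simp
  then show ?thesis
    unfolding power2_norm_eq_inner by (simp add: inner_simps inner_commute)
qed

text \<open>The constants 9 and 6 suit \<open>Phi_descent\<close>: an eighth of this bound must fit
  into the two available drops.\<close>

lemma potential_upper_bound:
  fixes a d e :: "'a::real_inner"
  assumes "norm e \<le> norm (a - d) / 4"
  shows "(norm a)\<^sup>2 + (norm (a - 2 *\<^sub>R e))\<^sup>2 \<le> 9 * (norm (a - d))\<^sup>2 + 6 * (norm d)\<^sup>2"
proof -
  define p q where "p = norm (a - d)" and "q = norm d"
  have pq: "0 \<le> p" "0 \<le> q"
    by (simp_all add: p_def q_def)
  have "norm a \<le> p + q"
    unfolding p_def q_def by norm
  then have 1: "(norm a)\<^sup>2 \<le> (p + q)\<^sup>2"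
    by (intro power_mono) auto
  have "norm (a - 2 *\<^sub>R e) \<le> 3/2 * p + q"
    using norm_triangle_ineq4[of a "2 *\<^sub>R e"] \<open>norm a \<le> p + q\<close> assms by (simp add: p_def)
  then have 2: "(norm (a - 2 *\<^sub>R e))\<^sup>2 \<le> (3/2 * p + q)\<^sup>2"
    by (intro power_mono) auto
  have "(p + q)\<^sup>2 + (3/2 * p + q)\<^sup>2 \<le> 9 * p\<^sup>2 + 6 * q\<^sup>2"
    using zero_le_power2[of "5 * p - 4 * q"] zero_le_power2[of p] zero_le_power2[of q]
    unfolding power2_eq_square by (simp only: algebra_simps)
  then show ?thesis
    using 1 2 unfolding p_def q_def by linarith
qed

section \<open>The method and its basic inequalities\<close>

locale projected_past_extragradient =
  fixes X :: "(real ^ 'd) set" and F :: "real ^ 'd \<Rightarrow> real ^ 'd"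
    and L \<gamma> :: real and xs :: "real ^ 'd" and x xt :: "nat \<Rightarrow> real ^ 'd"
  assumes nonempty: "X \<noteq> {}" and closed: "closed X" and convex: "convex X"
    and L_pos: "L > 0"
    and monotone: "monotone_operator_on X F"
    and lipschitz: "L-lipschitz_on X F"
    and solution: "VI_solution X F xs"
    and stepsize_pos: "0 < \<gamma>" and stepsize_le: "\<gamma> \<le> 1 / (4 * L)"
    and iterates: "past_extragradient X F \<gamma> x xt"
begin

text \<open>The distance part of \<open>Phi\<close>. It decreases on its own, which also keeps the
  iterates near the solution for the gap estimate.\<close>

definition V :: "nat \<Rightarrow> real" where
  "V k = (norm (x k - xs))\<^sup>2 + 1 / 16 * (norm (xt (k - 1) - xt (k - 2)))\<^sup>2"

lemma Phi_eq: "Phi F \<gamma> xs x xt k = V k + (3 * real k + 32) / 24 * Psi F \<gamma> x xt k"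
  by (simp add: Phi_def V_def)

lemma mono_ineq: "y \<in> X \<Longrightarrow> z \<in> X \<Longrightarrow> (F y - F z) \<bullet> (y - z) \<ge> 0"
  using monotone by (simp add: monotone_operator_on_def)

lemma lip_ineq: "y \<in> X \<Longrightarrow> z \<in> X \<Longrightarrow> norm (F y - F z) \<le> L * norm (y - z)"
  using lipschitz by (simp add: lipschitz_on_def dist_norm)

lemma stepsize_lipschitz: "\<gamma> * L \<le> 1 / 4"
  using stepsize_le L_pos by (simp add: field_simps)

lemma scaled_lip:
  assumes "y \<in> X" and "z \<in> X"
  shows "norm (\<gamma> *\<^sub>R (F y - F z)) \<le> \<gamma> * L * norm (y - z)"
    and "norm (\<gamma> *\<^sub>R (F y - F z)) \<le> norm (y - z) / 4"
proof -
  show *: "norm (\<gamma> *\<^sub>R (F y - F z)) \<le> \<gamma> * L * norm (y - z)"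
    using mult_left_mono[OF lip_ineq[OF assms], of \<gamma>] stepsize_pos by (simp add: mult.assoc)
  show "norm (\<gamma> *\<^sub>R (F y - F z)) \<le> norm (y - z) / 4"
    using * mult_right_mono[OF stepsize_lipschitz norm_ge_zero[of "y - z"]] by simp
qed

lemma projection_ineq:
  assumes "p = closest_point X q" and "y \<in> X"
  shows "(p - q) \<bullet> (y - p) \<ge> 0"
proof -
  have "(q - p) \<bullet> (y - p) \<le> 0"
    unfolding assms(1) by (rule closest_point_dot[OF convex closed assms(2)])
  then show ?thesis
    by (simp add: inner_diff_left)
qed

lemma projection_in: "closest_point X q \<in> X"
  by (rule closest_point_in_set[OF closed nonempty])

lemma x0_in: "x 0 \<in> X" and xt_0: "xt 0 = x 0"
  using iterates by (simp_all add: past_extragradient_def)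

text \<open>The first step fits the general update because \<open>xt 0 = x 0\<close>.\<close>

lemma x_Suc: "x (Suc k) = closest_point X (x k - \<gamma> *\<^sub>R F (xt k))"
  using iterates by (cases k) (simp_all add: past_extragradient_def)

lemma xt_Suc: "xt (Suc k) = closest_point X (x (Suc k) - \<gamma> *\<^sub>R F (xt k))"
  using iterates by (simp add: past_extragradient_def)

lemma x_in: "x k \<in> X"
  by (cases k) (simp_all add: x0_in x_Suc projection_in)

lemma xt_in: "xt k \<in> X"
  by (cases k) (simp_all add: x0_in xt_0 xt_Suc projection_in)

lemma xs_in: "xs \<in> X"
  using solution by (simp add: VI_solution_def)

lemma solution_ineq: "y \<in> X \<Longrightarrow> F xs \<bullet> (y - xs) \<ge> 0"
  using solution by (simp add: VI_solution_def)

text \<open>By monotonicity, a solution in the sense of Stampacchia also solves the Minty form of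
  the inequality.\<close>

lemma operator_ineq:
  assumes "y \<in> X"
  shows "F y \<bullet> (y - xs) \<ge> 0"
  using mono_ineq[OF assms xs_in] solution_ineq[OF assms] by (simp add: inner_diff_left)

section \<open>Descent of the potential, the distance part and \<open>Phi\<close>\<close>

lemma Psi_Suc:
  "Psi F \<gamma> x xt (Suc k) = (norm (x (Suc k) - x k))\<^sup>2
     + (norm (x (Suc k) - x k - 2 *\<^sub>R (\<gamma> *\<^sub>R (F (x (Suc k)) - F (xt k)))))\<^sup>2"
  by (simp add: Psi_def)

text \<open>The difference stays in the shape \<open>a - d\<close> to match the hypotheses of
  \<open>potential_descent\<close> and \<open>potential_upper_bound\<close>.\<close>

lemma residual_lip:
  "norm (\<gamma> *\<^sub>R (F (x (Suc (Suc k))) - F (xt (Suc k))))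
     \<le> norm (x (Suc (Suc k)) - x (Suc k) - (xt (Suc k) - x (Suc k))) / 4"
  using scaled_lip(2)[OF x_in xt_in, of "Suc (Suc k)" "Suc k"] by simp

lemma Psi_descent:
  "Psi F \<gamma> x xt (Suc (Suc k))
     \<le> Psi F \<gamma> x xt (Suc k) - 3/4 * (norm (x (Suc (Suc k)) - xt (Suc k)))\<^sup>2"
proof -
  define w u v t where "w = x k" and "u = x (Suc k)" and "v = x (Suc (Suc k))" and "t = xt (Suc k)"
  define g g' where "g = \<gamma> *\<^sub>R F t" and "g' = \<gamma> *\<^sub>R F (xt k)"
  have in_X: "u \<in> X" "v \<in> X" "t \<in> X"
    by (simp_all add: u_def v_def t_def x_in xt_in)
  have u: "u = closest_point X (w - g')" and v: "v = closest_point X (u - g)"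
    and t: "t = closest_point X (u - g')"
    by (simp_all add: w_def u_def v_def t_def g_def g'_def x_Suc xt_Suc)
  have "(norm (v - u))\<^sup>2 + (norm (v - u - 2 *\<^sub>R (\<gamma> *\<^sub>R (F v - F t))))\<^sup>2
    \<le> (norm (u - w))\<^sup>2 + (norm (u - w - 2 *\<^sub>R (\<gamma> *\<^sub>R (F u - F (xt k)))))\<^sup>2
      - 3/4 * (norm (v - u - (t - u)))\<^sup>2"
  proof (rule potential_descent)
    have "\<gamma> * ((F v - F u) \<bullet> (v - u)) \<ge> 0"
      using mono_ineq[OF in_X(2,1)] stepsize_pos by simp
    \<comment> \<open>The terms at the extrapolated points cancel, which leaves
      \<open>\<gamma> *\<^sub>R (F v - F u)\<close>.\<close>
    then show "(g + \<gamma> *\<^sub>R (F v - F t) - g' - \<gamma> *\<^sub>R (F u - F (xt k))) \<bullet> (v - u) \<ge> 0"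
      by (simp add: g_def g'_def algebra_simps inner_simps)
    show "(v - u + g) \<bullet> (v - u) \<le> 0"
      using projection_ineq[OF v in_X(1)] by (simp add: inner_simps algebra_simps)
    show "(u - w + g') \<bullet> (v - u) \<ge> 0"
      using projection_ineq[OF u in_X(2)] by (simp add: algebra_simps)
    show "(t - u + g') \<bullet> (v - u - (t - u)) \<ge> 0"
      using projection_ineq[OF t in_X(2)] by (simp add: algebra_simps)
    show "(u - w + g') \<bullet> (t - u) \<ge> 0"
      using projection_ineq[OF u in_X(3)] by (simp add: algebra_simps)
    show "norm (\<gamma> *\<^sub>R (F v - F t)) \<le> norm (v - u - (t - u)) / 4"
      unfolding v_def t_def u_def by (rule residual_lip)
  qed
  then show ?thesis
    by (simp add: Psi_Suc w_def u_def v_def t_def)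
qed

lemma distance_step:
  "(norm (x (Suc (Suc k)) - xs))\<^sup>2 \<le> (norm (x (Suc k) - xs))\<^sup>2
     - (norm (xt (Suc k) - x (Suc k)))\<^sup>2 + 1/16 * (norm (xt (Suc k) - xt k))\<^sup>2"
proof -
  define u v t where "u = x (Suc k)" and "v = x (Suc (Suc k))" and "t = xt (Suc k)"
  define g g' where "g = \<gamma> *\<^sub>R F t" and "g' = \<gamma> *\<^sub>R F (xt k)"
  have in_X: "v \<in> X" "t \<in> X"
    by (simp_all add: v_def t_def x_in xt_in)
  have v: "v = closest_point X (u - g)" and t: "t = closest_point X (u - g')"
    by (simp_all add: u_def v_def t_def g_def g'_def x_Suc xt_Suc)
  have "(norm (u - xs + (v - u)))\<^sup>2
    \<le> (norm (u - xs))\<^sup>2 - (norm (t - u))\<^sup>2 + (norm (g - g'))\<^sup>2"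
  proof (rule distance_descent)
    show "(v - u + g) \<bullet> (u - xs + (v - u)) \<le> 0"
      using projection_ineq[OF v xs_in] by (simp add: inner_simps algebra_simps)
    show "(t - u + g') \<bullet> (v - u - (t - u)) \<ge> 0"
      using projection_ineq[OF t in_X(1)] by (simp add: algebra_simps)
    show "g \<bullet> (u - xs + (t - u)) \<ge> 0"
      using operator_ineq[OF in_X(2)] stepsize_pos by (simp add: g_def)
  qed
  moreover have "(norm (g - g'))\<^sup>2 \<le> (norm (t - xt k) / 4)\<^sup>2"
    using scaled_lip(2)[OF in_X(2) xt_in, of k]
    by (intro power_mono) (simp_all add: g_def g'_def scaleR_diff_right)
  ultimately show ?thesis
    by (simp add: u_def v_def t_def power_divide)
qed

text \<open>Both points are projections of steps from the same base point \<open>x (Suc k)\<close>,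
  so nonexpansiveness leaves only the difference of two operator values.\<close>

lemma main_extrapolated_gap:
  "norm (x (Suc (Suc k)) - xt (Suc k)) \<le> norm (xt (Suc k) - xt k) / 4"
proof -
  have "norm (x (Suc (Suc k)) - xt (Suc k))
    \<le> dist (x (Suc k) - \<gamma> *\<^sub>R F (xt (Suc k))) (x (Suc k) - \<gamma> *\<^sub>R F (xt k))"
    unfolding x_Suc[of "Suc k"] xt_Suc dist_norm[symmetric]
    by (rule closest_point_lipschitz[OF convex closed nonempty])
  also have "\<dots> = norm (\<gamma> *\<^sub>R (F (xt (Suc k)) - F (xt k)))"
    by (simp add: dist_norm scaleR_diff_right norm_minus_commute)
  also have "\<dots> \<le> norm (xt (Suc k) - xt k) / 4"
    by (rule scaled_lip(2)[OF xt_in xt_in])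
  finally show ?thesis .
qed

text \<open>The gap between consecutive extrapolated points enters with weight 1/16 from
  \<open>V\<close> and 1/16 from \<open>distance_step\<close>. Splitting it at the main iterate
  between them costs 1/4 of the term dropped in \<open>distance_step\<close> and, by
  \<open>main_extrapolated_gap\<close>, 1/64 of the old squared gap, less than the 1/16 that
  \<open>V\<close> holds.\<close>

lemma V_descent:
  "V (Suc (Suc (Suc k)))
     \<le> V (Suc (Suc k)) - 3/4 * (norm (xt (Suc (Suc k)) - x (Suc (Suc k))))\<^sup>2"
proof -
  have "(norm (xt (Suc (Suc k)) - xt (Suc k)))\<^sup>2
    \<le> 2 * (norm (xt (Suc (Suc k)) - x (Suc (Suc k))))\<^sup>2
      + 2 * (norm (x (Suc (Suc k)) - xt (Suc k)))\<^sup>2"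
    using norm_add_power2_le[of "xt (Suc (Suc k)) - x (Suc (Suc k))" "x (Suc (Suc k)) - xt (Suc k)"]
    by simp
  moreover have "(norm (x (Suc (Suc k)) - xt (Suc k)))\<^sup>2 \<le> (norm (xt (Suc k) - xt k) / 4)\<^sup>2"
    using main_extrapolated_gap by (intro power_mono) auto
  then have "16 * (norm (x (Suc (Suc k)) - xt (Suc k)))\<^sup>2 \<le> (norm (xt (Suc k) - xt k))\<^sup>2"
    by (simp add: power_divide)
  moreover have "V (Suc (Suc (Suc k))) = (norm (x (Suc (Suc (Suc k))) - xs))\<^sup>2
      + 1/16 * (norm (xt (Suc (Suc k)) - xt (Suc k)))\<^sup>2"
    and "V (Suc (Suc k)) = (norm (x (Suc (Suc k)) - xs))\<^sup>2 + 1/16 * (norm (xt (Suc k) - xt k))\<^sup>2"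
    by (simp_all add: V_def)
  ultimately show ?thesis
    using distance_step[of "Suc k"] zero_le_power2[of "norm (xt (Suc k) - xt k)"] by linarith
qed

lemma Phi_descent:
  "Phi F \<gamma> xs x xt (Suc (Suc (Suc k))) \<le> Phi F \<gamma> xs x xt (Suc (Suc k))"
proof -
  define P Q where "P = (norm (x (Suc (Suc (Suc k))) - xt (Suc (Suc k))))\<^sup>2"
    and "Q = (norm (xt (Suc (Suc k)) - x (Suc (Suc k))))\<^sup>2"
  define c where "c = (3 * real (Suc (Suc k)) + 32) / 24"
  let ?\<Psi> = "Psi F \<gamma> x xt"
  have "P \<ge> 0" "c \<ge> 38 / 24"
    by (simp_all add: P_def c_def)
  have "?\<Psi> (Suc (Suc (Suc k))) \<le> 9 * P + 6 * Q"
    using potential_upper_bound[OF residual_lip[of "Suc k"]] unfolding P_def Q_def Psi_Suc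
    by simp
  moreover have "c * ?\<Psi> (Suc (Suc (Suc k))) \<le> c * (?\<Psi> (Suc (Suc k)) - 3/4 * P)"
    using Psi_descent[of "Suc k"] \<open>c \<ge> 38 / 24\<close> by (intro mult_left_mono) (auto simp: P_def)
  moreover have "38 / 24 * P \<le> c * P"
    using \<open>c \<ge> 38 / 24\<close> \<open>P \<ge> 0\<close> by (rule mult_right_mono)
  moreover have "V (Suc (Suc (Suc k))) \<le> V (Suc (Suc k)) - 3/4 * Q"
    using V_descent by (simp add: Q_def)
  moreover have "Phi F \<gamma> xs x xt (Suc (Suc (Suc k)))
      = V (Suc (Suc (Suc k))) + (c + 1/8) * ?\<Psi> (Suc (Suc (Suc k)))"
    unfolding Phi_eq c_def by (simp add: field_simps)
  moreover have "Phi F \<gamma> xs x xt (Suc (Suc k)) = V (Suc (Suc k)) + c * ?\<Psi> (Suc (Suc k))"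
    unfolding Phi_eq c_def by simp
  \<comment> \<open>The weight grows by 1/8, which costs at most \<open>9/8 * P + 3/4 * Q\<close>.
    The drop of \<open>V\<close> pays exactly for \<open>Q\<close>. The drop of the potential is
    worth \<open>3/4 * c * P\<close>, at least \<open>19/16 * P\<close>, since 38/24 is the weight
    at index 2.\<close>
  ultimately show ?thesis
    using \<open>P \<ge> 0\<close> by (simp add: algebra_simps)
qed

section \<open>Estimates for the first iterations\<close>

lemma first_step_le: "norm (x 1 - x 0) \<le> \<gamma> * norm (F (x 0))"
proof -
  have "dist (closest_point X (x 0 - \<gamma> *\<^sub>R F (x 0))) (closest_point X (x 0))
    \<le> dist (x 0 - \<gamma> *\<^sub>R F (x 0)) (x 0)"
    by (rule closest_point_lipschitz[OF convex closed nonempty])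
  then show ?thesis
    using stepsize_pos x_Suc[of 0] by (simp add: dist_norm xt_0 closest_point_self x0_in)
qed

lemma first_step_le_power2: "(norm (x 1 - x 0))\<^sup>2 \<le> \<gamma>\<^sup>2 * (norm (F (x 0)))\<^sup>2"
  using power_mono[OF first_step_le, of 2] by (simp add: power_mult_distrib)

text \<open>The first step is a plain projected forward step. Compared with the forward step at the
  solution, monotonicity discards the cross term and the Lipschitz bound yields the factor.\<close>

lemma first_distance_le: "(norm (x 1 - xs))\<^sup>2 \<le> (1 + \<gamma>\<^sup>2 * L\<^sup>2) * (norm (x 0 - xs))\<^sup>2"
proof -
  define z r p where "z = x 0 - xs" and "r = \<gamma> *\<^sub>R (F (x 0) - F xs)" and "p = x 1 - xs"
  have x1: "x 1 = closest_point X (x 0 - \<gamma> *\<^sub>R F (x 0))"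
    using x_Suc[of 0] by (simp add: xt_0)
  have eq: "x 1 - (x 0 - \<gamma> *\<^sub>R F (x 0)) = p - z + r + \<gamma> *\<^sub>R F xs" "xs - x 1 = - p"
    by (simp_all add: z_def r_def p_def algebra_simps)
  have "\<gamma> * (F xs \<bullet> p) \<ge> 0"
    using solution_ineq[OF x_in[of 1]] stepsize_pos by (simp add: p_def)
  then have "p \<bullet> p \<le> (z - r) \<bullet> p"
    using projection_ineq[OF x1 xs_in] unfolding eq by (simp add: inner_simps)
  \<comment> \<open>This is Cauchy-Schwarz in disguise, obtained by expanding the square of
    \<open>p - (z - r)\<close>.\<close>
  then have "p \<bullet> p \<le> (z - r) \<bullet> (z - r)"
    using inner_ge_zero[of "p - (z - r)"]
    unfolding inner_diff_left[of p] inner_diff_right[of _ p] inner_commute[of p "z - r"] by linarith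
  also have "\<dots> = (norm z)\<^sup>2 - 2 * (r \<bullet> z) + (norm r)\<^sup>2"
    unfolding power2_norm_eq_inner by (simp add: inner_simps inner_commute)
  also have "\<dots> \<le> (norm z)\<^sup>2 + (norm r)\<^sup>2"
    using mono_ineq[OF x0_in xs_in] stepsize_pos by (simp add: z_def r_def)
  also have "(norm r)\<^sup>2 \<le> (\<gamma> * L * norm z)\<^sup>2"
    using scaled_lip(1)[OF x0_in xs_in] by (intro power_mono) (simp_all add: r_def z_def)
  finally show ?thesis
    by (simp add: z_def p_def flip: power2_norm_eq_inner) (simp add: power_mult_distrib algebra_simps)
qed

lemma V_2_le:
  "V 2 \<le> (1 + \<gamma>\<^sup>2 * L\<^sup>2) * (norm (x 0 - xs))\<^sup>2 + 1/4 * (\<gamma>\<^sup>2 * (norm (F (x 0)))\<^sup>2)"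
proof -
  have "(norm (xt 1 - x 0))\<^sup>2 \<le> 2 * (norm (xt 1 - x 1))\<^sup>2 + 2 * (norm (x 1 - x 0))\<^sup>2"
    using norm_add_power2_le[of "xt 1 - x 1" "x 1 - x 0"] by simp
  moreover have "V 2 \<le> (norm (x 1 - xs))\<^sup>2 - (norm (xt 1 - x 1))\<^sup>2 + 1/8 * (norm (xt 1 - x 0))\<^sup>2"
    using distance_step[of 0] by (simp add: V_def xt_0 numeral_2_eq_2)
  ultimately show ?thesis
    using first_step_le_power2 first_distance_le zero_le_power2[of "norm (xt 1 - x 1)"] by linarith
qed

text \<open>As \<open>xt 0 = x 0\<close>, the residual is the operator difference across the step
  itself, so monotonicity gives its cross term the right sign.\<close>

lemma Psi_1_le: "Psi F \<gamma> x xt 1 \<le> (2 + 4 * \<gamma>\<^sup>2 * L\<^sup>2) * (\<gamma>\<^sup>2 * (norm (F (x 0)))\<^sup>2)"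
proof -
  define b r where "b = x 1 - x 0" and "r = \<gamma> *\<^sub>R (F (x 1) - F (x 0))"
  have "(norm r)\<^sup>2 \<le> (\<gamma> * L * norm b)\<^sup>2"
    using scaled_lip(1)[OF x_in x_in, of 1 0] by (intro power_mono) (simp_all add: r_def b_def)
  moreover have "r \<bullet> b \<ge> 0"
    using mono_ineq[OF x_in x_in, of 1 0] stepsize_pos by (simp add: r_def b_def)
  moreover have "Psi F \<gamma> x xt 1 = (norm b)\<^sup>2 + (norm (b - 2 *\<^sub>R r))\<^sup>2"
    using Psi_Suc[of 0] by (simp add: xt_0 b_def r_def)
  then have "Psi F \<gamma> x xt 1 = 2 * (norm b)\<^sup>2 - 4 * (r \<bullet> b) + 4 * (norm r)\<^sup>2"
    unfolding power2_norm_eq_inner by (simp add: inner_simps inner_commute)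
  ultimately have "Psi F \<gamma> x xt 1 \<le> (2 + 4 * \<gamma>\<^sup>2 * L\<^sup>2) * (norm b)\<^sup>2"
    by (simp add: power_mult_distrib algebra_simps)
  also have "\<dots> \<le> (2 + 4 * \<gamma>\<^sup>2 * L\<^sup>2) * (\<gamma>\<^sup>2 * (norm (F (x 0)))\<^sup>2)"
    using first_step_le_power2 by (intro mult_left_mono) (simp_all add: b_def)
  finally show ?thesis .
qed

lemma Phi_2_le: "Phi F \<gamma> xs x xt 2 \<le> (H0\<gamma> F L \<gamma> (x 0) xs)\<^sup>2"
proof -
  define l D f where "l = \<gamma>\<^sup>2 * L\<^sup>2" and "D = (norm (x 0 - xs))\<^sup>2" and "f = \<gamma>\<^sup>2 * (norm (F (x 0)))\<^sup>2"
  have nonneg: "l \<ge> 0" "D \<ge> 0" "f \<ge> 0"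
    by (simp_all add: l_def D_def f_def)
  have "Psi F \<gamma> x xt 2 \<le> (2 + 4 * l) * f"
    using Psi_descent[of 0] Psi_1_le zero_le_power2[of "norm (x 2 - xt 1)"]
    unfolding l_def f_def One_nat_def numeral_2_eq_2 mult.assoc by linarith
  \<comment> \<open>The weight at index 2 is 38/24. Collecting terms gives 1/4 + 19/6 = 41/12 and 4
    * 38/24 = 19/3, the coefficients in \<open>H0\<gamma>\<close>.\<close>
  then have "Phi F \<gamma> xs x xt 2 \<le> (1 + l) * D + 1/4 * f + 38/24 * ((2 + 4 * l) * f)"
    using V_2_le by (simp add: Phi_eq l_def D_def f_def)
  also have "\<dots> \<le> 2 * (1 + 3 * l + 4 * l\<^sup>2) * D + (41/12 + 19/3 * l) * f"
  proof -
    have "(1 + l) * D \<le> 2 * (1 + 3 * l + 4 * l\<^sup>2) * D"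
      using nonneg by (intro mult_right_mono) auto
    then show ?thesis
      by (simp add: algebra_simps)
  qed
  also have "\<dots> = (H0\<gamma> F L \<gamma> (x 0) xs)\<^sup>2"
    using nonneg unfolding H0\<gamma>_def l_def D_def f_def
    by (subst real_sqrt_pow2) (auto simp: power_mult_distrib algebra_simps intro!: add_nonneg_nonneg)
  finally show ?thesis .
qed

section \<open>Bounds for all later iterates\<close>

lemma Phi_le:
  assumes "N \<ge> 2"
  shows "Phi F \<gamma> xs x xt N \<le> (H0\<gamma> F L \<gamma> (x 0) xs)\<^sup>2"
  using assms
proof (induction N rule: dec_induct)
  case (step n)
  then obtain k where "n = Suc (Suc k)"
    by (metis Suc_le_D Suc_le_mono numeral_2_eq_2)
  with step Phi_descent[of k] show ?case
    by simp
qed (rule Phi_2_le)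

lemma V_le:
  assumes "N \<ge> 2"
  shows "V N \<le> V 2"
  using assms
proof (induction N rule: dec_induct)
  case (step n)
  then obtain k where "n = Suc (Suc k)"
    by (metis Suc_le_D Suc_le_mono numeral_2_eq_2)
  then have "V (Suc n) \<le> V n - 3/4 * (norm (xt n - x n))\<^sup>2"
    using V_descent by simp
  also have "\<dots> \<le> V n"
    by simp
  finally show ?case
    using step.IH by simp
qed simp

lemma Psi_le:
  assumes "N \<ge> 2"
  shows "Psi F \<gamma> x xt N \<le> 24 * (H0\<gamma> F L \<gamma> (x 0) xs)\<^sup>2 / (3 * real N + 32)"
proof -
  have "V N \<ge> 0"
    by (simp add: V_def)
  then have "(3 * real N + 32) / 24 * Psi F \<gamma> x xt N \<le> (H0\<gamma> F L \<gamma> (x 0) xs)\<^sup>2"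
    using Phi_le[OF assms] by (simp add: Phi_eq)
  then show ?thesis
    by (simp add: field_simps)
qed

lemma H0_nonneg: "H0 F L (x 0) xs \<ge> 0"
  by (simp add: H0_def)

lemma H0_power2:
  "(H0 F L (x 0) xs)\<^sup>2 = 3 * (norm (x 0 - xs))\<^sup>2 + 1 / (30 * L\<^sup>2) * (norm (F (x 0)))\<^sup>2"
  by (simp add: H0_def)

text \<open>\<open>V\<close> never exceeds \<open>V 2\<close>, and \<gamma>L \<le> 1/4 brings the
  coefficients of \<open>V_2_le\<close> below those of the squared \<open>H0\<close>: 1 + 1/16 \<le>
  3 and 1/64 \<le> 1/30.\<close>

lemma distance_le_H0:
  assumes "N \<ge> 2"
  shows "norm (x N - xs) \<le> H0 F L (x 0) xs"
proof (rule power2_le_imp_le[OF _ H0_nonneg])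
  have sq: "\<gamma>\<^sup>2 * L\<^sup>2 \<le> 1/16"
    using power_mono[OF stepsize_lipschitz, of 2] stepsize_pos L_pos
    by (simp add: power_mult_distrib power_divide)
  have 1: "(1 + \<gamma>\<^sup>2 * L\<^sup>2) * (norm (x 0 - xs))\<^sup>2 \<le> 3 * (norm (x 0 - xs))\<^sup>2"
    using sq by (intro mult_right_mono) auto
  have "1/4 * \<gamma>\<^sup>2 \<le> 1 / (30 * L\<^sup>2)"
    using sq L_pos by (simp add: field_simps)
  then have 2: "1/4 * \<gamma>\<^sup>2 * (norm (F (x 0)))\<^sup>2 \<le> 1 / (30 * L\<^sup>2) * (norm (F (x 0)))\<^sup>2"
    by (rule mult_right_mono) simp
  have "(norm (x N - xs))\<^sup>2 \<le> V N"
    by (simp add: V_def)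
  then show "(norm (x N - xs))\<^sup>2 \<le> (H0 F L (x 0) xs)\<^sup>2"
    using V_le[OF assms] V_2_le 1 2 unfolding H0_power2 by linarith
qed

section \<open>The restricted gap\<close>

text \<open>The squares of the two summands of the radius add up to the square of \<open>H0\<close>,
  so each summand is at most \<open>H0\<close>.\<close>

lemma gap_radius_le: "gap_radius F L (x 0) xs \<le> 2 * H0 F L (x 0) xs"
proof -
  have "sqrt 3 * norm (x 0 - xs) = sqrt (3 * (norm (x 0 - xs))\<^sup>2)"
    by (simp add: real_sqrt_mult)
  also have "\<dots> \<le> H0 F L (x 0) xs"
    unfolding H0_def by (intro real_sqrt_le_mono) simp
  finally have 1: "sqrt 3 * norm (x 0 - xs) \<le> H0 F L (x 0) xs" .
  have "1 / (sqrt 30 * L) * norm (F (x 0)) = sqrt (1 / (30 * L\<^sup>2) * (norm (F (x 0)))\<^sup>2)"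
    using L_pos by (simp add: real_sqrt_mult real_sqrt_divide)
  also have "\<dots> \<le> H0 F L (x 0) xs"
    unfolding H0_def by (intro real_sqrt_le_mono) simp
  finally show ?thesis
    using 1 by (simp add: gap_radius_def)
qed

lemma gap_radius_nonneg: "gap_radius F L (x 0) xs \<ge> 0"
  using L_pos by (simp add: gap_radius_def)

text \<open>The vector \<open>r - a\<close> is \<gamma>F at \<open>x N\<close> plus the normal
  vector produced by the projection, and it is minus the mean of the two vectors in
  \<open>Psi\<close>. Its norm therefore controls the gap at every test point.\<close>

lemma gap_pointwise:
  assumes N: "N \<ge> 1" and y: "y \<in> X"
  shows "\<gamma> * (F y \<bullet> (x N - y)) \<le> sqrt (Psi F \<gamma> x xt N / 2) * norm (x N - y)"
proof -
  obtain k where k: "N = Suc k"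
    using N by (cases N) auto
  define a r where "a = x N - x k" and "r = \<gamma> *\<^sub>R (F (x N) - F (xt k))"
  have "a + (a - 2 *\<^sub>R r) = 2 *\<^sub>R (a - r)"
    by (simp add: scaleR_2 algebra_simps)
  then have "4 * (norm (a - r))\<^sup>2 \<le> 2 * Psi F \<gamma> x xt N"
    using norm_add_power2_le[of a "a - 2 *\<^sub>R r"]
    unfolding k Psi_Suc by (simp add: a_def r_def k power_mult_distrib)
  then have "(norm (a - r))\<^sup>2 \<le> Psi F \<gamma> x xt N / 2"
    by simp
  then have norm_le: "norm (r - a) \<le> sqrt (Psi F \<gamma> x xt N / 2)"
    by (simp add: norm_minus_commute real_le_rsqrt)
  have "\<gamma> * (F y \<bullet> (x N - y)) \<le> \<gamma> * (F (x N) \<bullet> (x N - y))"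
    using mono_ineq[OF x_in y, of N] stepsize_pos by (simp add: inner_diff_left)
  also have "\<dots> \<le> (r - a) \<bullet> (x N - y)"
    using projection_ineq[OF x_Suc[of k] y]
    by (simp add: k a_def r_def inner_simps algebra_simps)
  also have "\<dots> \<le> norm (r - a) * norm (x N - y)"
    by (rule norm_cauchy_schwarz)
  also have "\<dots> \<le> sqrt (Psi F \<gamma> x xt N / 2) * norm (x N - y)"
    using norm_le by (intro mult_right_mono) auto
  finally show ?thesis .
qed

text \<open>Compactness supplies a maximiser, which gives the \<open>GREATEST\<close> its value and
  lets \<open>gap_pointwise\<close> apply to a single point.\<close>

lemma restricted_gap_attained:
  obtains y where "y \<in> X" and "norm (y - xs) \<le> gap_radius F L (x 0) xs"
    and "restricted_gap X F L (x 0) xs z = F y \<bullet> (z - y)"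
proof -
  let ?R = "gap_radius F L (x 0) xs"
  let ?K = "X \<inter> cball xs ?R"
  have "compact ?K"
    using closed by (simp add: closed_Int_compact)
  moreover have "?K \<noteq> {}"
    using xs_in gap_radius_nonneg by auto
  moreover have "continuous_on ?K (\<lambda>y. F y \<bullet> (z - y))"
    by (intro continuous_intros continuous_on_subset[OF lipschitz_on_continuous_on[OF lipschitz]]) auto
  ultimately obtain y where y: "y \<in> ?K" and max: "\<forall>w\<in>?K. F w \<bullet> (z - w) \<le> F y \<bullet> (z - y)"
    using continuous_attains_sup by blast
  have "restricted_gap X F L (x 0) xs z = F y \<bullet> (z - y)"
    unfolding restricted_gap_def
    using y max by (intro Greatest_equality) (auto simp: dist_norm norm_minus_commute)
  then show ?thesis
    using that[of y] y by (auto simp: dist_norm norm_minus_commute)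
qed

lemma restricted_gap_le:
  assumes "N \<ge> 2"
  shows "restricted_gap X F L (x 0) xs (x N)
    \<le> 8 * sqrt 3 * H0\<gamma> F L \<gamma> (x 0) xs * H0 F L (x 0) xs / (\<gamma> * sqrt (3 * real N + 32))"
proof -
  let ?h = "H0\<gamma> F L \<gamma> (x 0) xs" and ?R = "H0 F L (x 0) xs"
  obtain y where y: "y \<in> X" "norm (y - xs) \<le> gap_radius F L (x 0) xs"
    and gap: "restricted_gap X F L (x 0) xs (x N) = F y \<bullet> (x N - y)"
    by (rule restricted_gap_attained)
  have "?h \<ge> 0"
    by (simp add: H0\<gamma>_def)
  have "norm (x N - y) \<le> norm (x N - xs) + norm (y - xs)"
    by norm
  \<comment> \<open>The summands are at most \<open>H0\<close> and twice \<open>H0\<close>; rounding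
    3 up to 4 matches the stated constant 8 = 2 * 4.\<close>
  then have dist: "norm (x N - y) \<le> 4 * ?R"
    using distance_le_H0[OF assms] y(2) gap_radius_le H0_nonneg by linarith
  have "sqrt (Psi F \<gamma> x xt N / 2) \<le> sqrt (2\<^sup>2 * 3 * ?h\<^sup>2 / (3 * real N + 32))"
    using Psi_le[OF assms] by (intro real_sqrt_le_mono) simp
  also have "\<dots> = 2 * sqrt 3 * ?h / sqrt (3 * real N + 32)"
    using \<open>?h \<ge> 0\<close> by (simp only: real_sqrt_mult real_sqrt_divide real_sqrt_abs)
  finally have "\<gamma> * (F y \<bullet> (x N - y)) \<le> 2 * sqrt 3 * ?h / sqrt (3 * real N + 32) * (4 * ?R)"
    using assms dist \<open>?h \<ge> 0\<close>
    by (intro order_trans[OF gap_pointwise[OF _ y(1)] mult_mono]) auto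
  then show ?thesis
    using stepsize_pos unfolding gap by (simp add: field_simps)
qed

end

theorem theorem2:
  fixes X :: "(real ^ 'd) set" and F :: "real ^ 'd \<Rightarrow> real ^ 'd"
    and L \<gamma> :: real and xs :: "real ^ 'd" and x xt :: "nat \<Rightarrow> real ^ 'd"
  assumes "X \<noteq> {}" and "closed X" and "convex X"
    and "L > 0"
    and "monotone_operator_on X F"
    and "L-lipschitz_on X F"
    and "VI_solution X F xs"
    and "0 < \<gamma>" and "\<gamma> \<le> 1 / (4 * L)"
    and "past_extragradient X F \<gamma> x xt"
  shows "(\<forall>k\<ge>2. Phi F \<gamma> xs x xt (k + 1) \<le> Phi F \<gamma> xs x xt k) \<and>
    (\<forall>N\<ge>2.
       (norm (x N - x (N - 1)))\<^sup>2 \<le> 24 * (H0\<gamma> F L \<gamma> (x 0) xs)\<^sup>2 / (3 * real N + 32) \<and>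
       restricted_gap X F L (x 0) xs (x N)
         \<le> 8 * sqrt 3 * H0\<gamma> F L \<gamma> (x 0) xs * H0 F L (x 0) xs / (\<gamma> * sqrt (3 * real N + 32)))"
proof -
  interpret projected_past_extragradient X F L \<gamma> xs x xt
    using assms by unfold_locales
  show ?thesis
  proof (intro conjI allI impI)
    fix k :: nat
    assume "k \<ge> 2"
    then obtain j where "k = Suc (Suc j)"
      by (metis Suc_le_D numeral_2_eq_2 Suc_le_mono)
    then show "Phi F \<gamma> xs x xt (k + 1) \<le> Phi F \<gamma> xs x xt k"
      using Phi_descent[of j] by simp
  next
    fix N :: nat
    assume N: "N \<ge> 2"
    have "(norm (x N - x (N - 1)))\<^sup>2 \<le> Psi F \<gamma> x xt N"
      by (simp add: Psi_def)
    then show "(norm (x N - x (N - 1)))\<^sup>2 \<le> 24 * (H0\<gamma> F L \<gamma> (x 0) xs)\<^sup>2 / (3 * real N + 32)"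
      using Psi_le[OF N] by linarith
    show "restricted_gap X F L (x 0) xs (x N)
      \<le> 8 * sqrt 3 * H0\<gamma> F L \<gamma> (x 0) xs * H0 F L (x 0) xs / (\<gamma> * sqrt (3 * real N + 32))"
      using restricted_gap_le[OF N] .
  qed
qed

end
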